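(* Let $\mathcal{S}=(X,\Sigma,\to,\leq,x_0)$ be an ideally effective cover-WSTS such that $\mathrm{Post}$ is computable. Then the $x_0$-coverability problem is decidable: given $y\in X$, it is decidable whether $y\in\downarrow\mathrm{Post}^*_{\mathcal{S}}(x_0)$.
   Context: $\mathcal{S}$ has state set $X$, finite alphabet $\Sigma$, transitions ${\to}\subseteq X\times\Sigma\times X$, quasi-ordering $\leq$, initial state $x_0$; $\mathrm{Post}(x)=\{y\mid x\to y\}$, $\mathrm{Post}^*(x)$ the states reachable from $x$, $\downarrow Y=\{z\mid z\leq y\text{ for some }y\in Y\}$, and $\mathrm{Cover}(x_0)=\downarrow\mathrm{Post}^*(x_0)$. $\mathcal{S}$ is cover-monotone if for all $y_1\in\mathrm{Cover}(x_0)$ and $x_1,x_2$ with $x_1\leq y_1$ and $x_1\to x_2$ there is $y_2$ with $y_1\xrightarrow{*}y_2$ and $x_2\leq y_2$. A cover-WSTS is a finitely branching (each $\mathrm{Post}(x)$ finite) cover-monotone system with $(X,\leq)$ a well-quasi-ordering. An ideal is a non-empty downward-closed set $I$ that is directed (for all $x,y\in I$ there is $z\in I$ with $x\leq z$, $y\leq z$). Ideally effective: the set of encodings of ideals of $X$ is recursive; the map from (an encoding of) $x\in X$ to (an encoding of) the ideal $\downarrow x$ is computable; inclusion of ideals is decidable; and for each ideal $I$, $\downarrow\mathrm{Post}(I)$ is computable as a finite union of ideals. *)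

theory Defs
  imports Main "HOL-Library.Nat_Bijection"
begin

section \<open>Partial recursive functions\<close>

text \<open>
  Programs for Kleene's partial recursive functions. The arity is left implicit: a program
  denotes one partial function for every length of the argument list, and \<open>None\<close> means
  divergence (or, for \<open>Succ\<close>, \<open>Proj\<close> and \<open>PrimRec\<close>, an argument list that is too short).
\<close>

datatype prog =
    Zero
  | Succ
  | Proj nat
  | Comp prog "prog list"
  | PrimRec prog prog
  | Mu prog

text \<open>
  Composition is strict. \<open>PrimRec f g\<close> recurses on the first argument, and \<open>g\<close> receives the
  predecessor, the recursive result and the parameters, in this order. \<open>Mu f\<close> requires \<open>f\<close> to
  converge on all candidates below the least zero.
\<close>

primrec run :: "prog \<Rightarrow> nat list \<Rightarrow> nat option" where
  "run Zero xs = Some 0"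
| "run Succ xs = (case xs of [] \<Rightarrow> None | x # _ \<Rightarrow> Some (Suc x))"
| "run (Proj i) xs = (if i < length xs then Some (xs ! i) else None)"
| "run (Comp f gs) xs = Option.bind (those (map (\<lambda>g. run g xs) gs)) (run f)"
| "run (PrimRec f g) xs =
     (case xs of
        [] \<Rightarrow> None
      | n # ys \<Rightarrow> rec_nat (run f ys) (\<lambda>m r. Option.bind r (\<lambda>v. run g (m # v # ys))) n)"
| "run (Mu f) xs =
     (if \<exists>n. run f (n # xs) = Some 0 \<and> (\<forall>m<n. run f (m # xs) \<noteq> None)
      then Some (LEAST n. run f (n # xs) = Some 0)
      else None)"

text \<open>A Goedel numbering of programs.\<close>

primrec prog_encode :: "prog \<Rightarrow> nat" where
  "prog_encode Zero = prod_encode (0, 0)"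
| "prog_encode Succ = prod_encode (1, 0)"
| "prog_encode (Proj i) = prod_encode (2, i)"
| "prog_encode (Comp f gs) =
     prod_encode (3, prod_encode (prog_encode f, list_encode (map prog_encode gs)))"
| "prog_encode (PrimRec f g) = prod_encode (4, prod_encode (prog_encode f, prog_encode g))"
| "prog_encode (Mu f) = prod_encode (5, prog_encode f)"

lemma prog_encode_inject: "prog_encode p = prog_encode q \<Longrightarrow> p = q"
proof (induction p arbitrary: q)
  case Zero
  then show ?case by (cases q) auto
next
  case Succ
  then show ?case by (cases q) auto
next
  case (Proj i)
  then show ?case by (cases q) auto
next
  case (Comp f gs)
  from Comp.prems obtain f' gs' where q: "q = Comp f' gs'"
    and f: "prog_encode f = prog_encode f'"
    and gs: "list_encode (map prog_encode gs) = list_encode (map prog_encode gs')"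
    by (cases q) auto
  from gs have "map prog_encode gs = map prog_encode gs'"
    by (metis list_encode_inverse)
  then have "gs = gs'"
    using Comp.IH(2)
    by (metis (no_types, lifting) length_map nth_equalityI nth_map nth_mem)
  with Comp.IH(1)[OF f] q show ?case by simp
next
  case (PrimRec f g)
  then show ?case by (cases q) auto
next
  case (Mu f)
  then show ?case by (cases q) auto
qed

section \<open>Ordered labelled transition systems\<close>

record ('x, 'a) lts =
  states :: "'x set"
  alphabet :: "'a set"
  trans :: "('x \<times> 'a \<times> 'x) set"
  leq :: "'x \<Rightarrow> 'x \<Rightarrow> bool"
  init :: 'x

definition ordered_lts :: "('x, 'a) lts \<Rightarrow> bool" where
  "ordered_lts S \<longleftrightarrow>
     finite (alphabet S) \<and>
     trans S \<subseteq> states S \<times> alphabet S \<times> states S \<and>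
     reflp_on (states S) (leq S) \<and> transp_on (states S) (leq S) \<and>
     init S \<in> states S"

definition step :: "('x, 'a) lts \<Rightarrow> 'x \<Rightarrow> 'x \<Rightarrow> bool" where
  "step S x y \<longleftrightarrow> (\<exists>a. (x, a, y) \<in> trans S)"

definition Post :: "('x, 'a) lts \<Rightarrow> 'x \<Rightarrow> 'x set" where
  "Post S x = {y. step S x y}"

definition Post_star :: "('x, 'a) lts \<Rightarrow> 'x \<Rightarrow> 'x set" where
  "Post_star S x = {y. (step S)\<^sup>*\<^sup>* x y}"

definition Down :: "('x, 'a) lts \<Rightarrow> 'x set \<Rightarrow> 'x set" where
  "Down S Y = {z \<in> states S. \<exists>y\<in>Y. leq S z y}"

definition Cover :: "('x, 'a) lts \<Rightarrow> 'x set" where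
  "Cover S = Down S (Post_star S (init S))"

definition finitely_branching :: "('x, 'a) lts \<Rightarrow> bool" where
  "finitely_branching S \<longleftrightarrow> (\<forall>x\<in>states S. finite (Post S x))"

definition cover_monotone :: "('x, 'a) lts \<Rightarrow> bool" where
  "cover_monotone S \<longleftrightarrow>
     (\<forall>y1\<in>Cover S. \<forall>x1\<in>states S. \<forall>x2\<in>states S.
        leq S x1 y1 \<and> step S x1 x2 \<longrightarrow> (\<exists>y2. (step S)\<^sup>*\<^sup>* y1 y2 \<and> leq S x2 y2))"

definition well_quasi_ordered :: "('x, 'a) lts \<Rightarrow> bool" where
  "well_quasi_ordered S \<longleftrightarrow>
     (\<forall>f :: nat \<Rightarrow> 'x. range f \<subseteq> states S \<longrightarrow> (\<exists>i j. i < j \<and> leq S (f i) (f j)))"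

definition cover_wsts :: "('x, 'a) lts \<Rightarrow> bool" where
  "cover_wsts S \<longleftrightarrow>
     ordered_lts S \<and> finitely_branching S \<and> cover_monotone S \<and> well_quasi_ordered S"

definition ideal :: "('x, 'a) lts \<Rightarrow> 'x set \<Rightarrow> bool" where
  "ideal S I \<longleftrightarrow>
     I \<noteq> {} \<and> I \<subseteq> states S \<and>
     (\<forall>y\<in>I. \<forall>x\<in>states S. leq S x y \<longrightarrow> x \<in> I) \<and>
     (\<forall>x\<in>I. \<forall>y\<in>I. \<exists>z\<in>I. leq S x z \<and> leq S y z)"

section \<open>Effectivity\<close>

text \<open>
  An encoding of a set \<open>A\<close> is a partial surjection from the natural numbers onto \<open>A\<close>: its domain
  is the set of encodings, and an element may have several of them. A finite subset of \<open>A\<close> is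
  given by the \<open>list_encode\<close> of a list of encodings of its elements.
\<close>

type_synonym 'c encoding = "nat \<Rightarrow> 'c option"

definition encodes_set :: "'c encoding \<Rightarrow> nat \<Rightarrow> 'c set \<Rightarrow> bool" where
  "encodes_set e n A \<longleftrightarrow> e ` set (list_decode n) = Some ` A"

text \<open>
  The programs \<open>pr\<close>, \<open>pd\<close>, \<open>ps\<close>, \<open>pp\<close> respectively recognise the encodings of ideals, compute
  \<open>x \<mapsto> Down {x}\<close>, decide inclusion of ideals, and decompose \<open>Down (Post I)\<close>
  into finitely many ideals (possibly none). Apart from \<open>pr\<close>, behaviour is only prescribed on
  encodings of states and of ideals; in particular the set of encodings of states need not be
  recursive.
\<close>

definition ideally_effective_by ::
  "('x, 'a) lts \<Rightarrow> 'x encoding \<Rightarrow> 'x set encoding \<Rightarrow> prog \<Rightarrow> prog \<Rightarrow> prog \<Rightarrow> prog \<Rightarrow> bool" where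
  "ideally_effective_by S eX eI pr pd ps pp \<longleftrightarrow>
     ran eX = states S \<and> ran eI = {I. ideal S I} \<and>
     (\<forall>i. run pr [i] = Some (of_bool (i \<in> dom eI))) \<and>
     (\<forall>c x. eX c = Some x \<longrightarrow> (\<exists>i. run pd [c] = Some i \<and> eI i = Some (Down S {x}))) \<and>
     (\<forall>i I j J. eI i = Some I \<and> eI j = Some J \<longrightarrow> run ps [i, j] = Some (of_bool (I \<subseteq> J))) \<and>
     (\<forall>i I. eI i = Some I \<longrightarrow>
        (\<exists>n \<J>. run pp [i] = Some n \<and> encodes_set eI n \<J> \<and>
               Down S (\<Union>x\<in>I. Post S x) = \<Union>\<J>))"

definition ideally_effective :: "('x, 'a) lts \<Rightarrow> 'x encoding \<Rightarrow> 'x set encoding \<Rightarrow> bool" where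
  "ideally_effective S eX eI \<longleftrightarrow> (\<exists>pr pd ps pp. ideally_effective_by S eX eI pr pd ps pp)"

definition Post_computable_by :: "('x, 'a) lts \<Rightarrow> 'x encoding \<Rightarrow> prog \<Rightarrow> bool" where
  "Post_computable_by S eX p \<longleftrightarrow>
     (\<forall>c x. eX c = Some x \<longrightarrow> (\<exists>n. run p [c] = Some n \<and> encodes_set eX n (Post S x)))"

definition Post_computable :: "('x, 'a) lts \<Rightarrow> 'x encoding \<Rightarrow> bool" where
  "Post_computable S eX \<longleftrightarrow> (\<exists>p. Post_computable_by S eX p)"

definition coverability_decidable_by :: "('x, 'a) lts \<Rightarrow> 'x encoding \<Rightarrow> prog \<Rightarrow> bool" where
  "coverability_decidable_by S eX q \<longleftrightarrow>
     (\<forall>c y. eX c = Some y \<longrightarrow>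
        run q [c] = Some (of_bool (y \<in> Down S (Post_star S (init S)))))"

definition coverability_decidable :: "('x, 'a) lts \<Rightarrow> 'x encoding \<Rightarrow> bool" where
  "coverability_decidable S eX \<longleftrightarrow> (\<exists>q. coverability_decidable_by S eX q)"

text \<open>
  For a single fixed system, \<open>coverability_decidable\<close> lets the decision procedure depend on the
  system in an arbitrary way. By the well-quasi-ordering, \<open>Cover S\<close> is a finite union of ideals,
  whose encodings could simply be stored in the program. The following notion demands in
  addition that the decision procedure be found effectively: one program \<open>t\<close> transforms (the
  Goedel numbers of) the programs witnessing the effectivity of any system over the given types,
  together with an encoding of its initial state, into a program deciding coverability for it.
\<close>

definition coverability_uniformly_decidable :: "('x, 'a) lts itself \<Rightarrow> bool" where
  "coverability_uniformly_decidable _ \<longleftrightarrow>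
     (\<exists>t. \<forall>(S :: ('x, 'a) lts) eX eI pr pd ps pp p c0.
        cover_wsts S \<and> ideally_effective_by S eX eI pr pd ps pp \<and> Post_computable_by S eX p \<and>
        eX c0 = Some (init S) \<longrightarrow>
        (\<exists>q. run t (map prog_encode [pr, pd, ps, pp, p] @ [c0]) = Some (prog_encode q) \<and>
             coverability_decidable_by S eX q))"

end

theory Submission
  imports Defs
begin

text \<open>
  A downward closed set that contains \<open>x\<^sub>0\<close> and is closed under \<open>Post\<close> includes the cover, and by
  cover-monotonicity the cover itself is such a set. By the well-quasi-ordering it is a finite
  union of ideals. Hence either \<open>y\<close> is below a state reached by some finite path, or some finite
  list of ideals is an invariant that avoids \<open>y\<close>, and both kinds of witnesses can be recognised:
  an ideal included in a finite union of ideals is included in one of them. The decision procedure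
  searches for either witness. It uses the given programs as black boxes, so that its Goedel
  number is obtained from theirs by pairing alone and no universal program is needed.
\<close>

section \<open>Ideals in well-quasi-orders\<close>

definition down_closed :: "('x, 'a) lts \<Rightarrow> 'x set \<Rightarrow> bool" where
  "down_closed S D \<longleftrightarrow> D \<subseteq> states S \<and> (\<forall>y\<in>D. \<forall>x\<in>states S. leq S x y \<longrightarrow> x \<in> D)"

lemma ideal_iff:
  "ideal S I \<longleftrightarrow>
     I \<noteq> {} \<and> down_closed S I \<and> (\<forall>x\<in>I. \<forall>y\<in>I. \<exists>z\<in>I. leq S x z \<and> leq S y z)"
  unfolding ideal_def down_closed_def by blast

text \<open>From an infinite strictly descending chain pick an element \<open>g i\<close> lost at
  each step. A pair \<open>i < j\<close> with \<open>g i\<close> below \<open>g j\<close> would put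
  \<open>g i\<close> back into \<open>f (Suc i)\<close>, because \<open>g j\<close> still lies
  there.\<close>

lemma wf_down_closed:
  assumes "well_quasi_ordered S"
  shows "wf {(D, E). down_closed S D \<and> down_closed S E \<and> D \<subset> E}"
  unfolding wf_iff_no_infinite_down_chain
proof
  assume "\<exists>f. \<forall>i. (f (Suc i), f i) \<in> {(D, E). down_closed S D \<and> down_closed S E \<and> D \<subset> E}"
  then obtain f where f: "\<And>i. down_closed S (f i)" "\<And>i. f (Suc i) \<subset> f i"
    by blast
  have "\<forall>i. \<exists>x. x \<in> f i - f (Suc i)"
    using f(2) by blast
  then obtain g where g: "\<And>i. g i \<in> f i - f (Suc i)"
    by metis
  then have "range g \<subseteq> states S"
    using f(1) unfolding down_closed_def by blast
  then obtain i j where ij: "i < j" "leq S (g i) (g j)"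
    using assms unfolding well_quasi_ordered_def by metis
  have st: "g i \<in> states S"
    using \<open>range g \<subseteq> states S\<close> by auto
  have "f j \<subseteq> f (Suc i)"
    by (rule lift_Suc_antimono_le[of f]) (use f(2) ij(1) in \<open>auto simp: psubset_eq\<close>)
  then have "g j \<in> f (Suc i)"
    using g[of j] by blast
  then have "g i \<in> f (Suc i)"
    using f(1)[of "Suc i"] ij(2) st unfolding down_closed_def by simp
  with g[of i] show False by simp
qed

text \<open>Noetherian induction: a non-empty non-ideal has two elements without a common upper
  bound inside it, so it is the union of two strictly smaller downward closed sets, each omitting
  everything above one of the two elements.\<close>

lemma down_closed_Union_ideals:
  assumes S: "ordered_lts S" "well_quasi_ordered S" and "down_closed S D"
  shows "\<exists>F. finite F \<and> (\<forall>I\<in>F. ideal S I) \<and> D = \<Union>F"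
  using wf_down_closed[OF S(2)] \<open>down_closed S D\<close>
proof (induction D rule: wf_induct_rule)
  case (less D)
  show ?case
  proof (cases "D = {} \<or> ideal S D")
    case True
    then show ?thesis
      by (metis Union_empty ccpo_Sup_singleton empty_iff finite.emptyI finite.insertI singletonD)
  next
    case False
    then obtain x y where xy: "x \<in> D" "y \<in> D" "\<And>z. z \<in> D \<Longrightarrow> \<not> (leq S x z \<and> leq S y z)"
      using less.prems unfolding ideal_iff by blast
    let ?C = "\<lambda>x. {z \<in> D. \<not> leq S x z}"
    have refl: "leq S x x" and trans: "\<And>a b c. a \<in> states S \<Longrightarrow> b \<in> states S \<Longrightarrow> c \<in> states S
      \<Longrightarrow> leq S a b \<Longrightarrow> leq S b c \<Longrightarrow> leq S a c" if "x \<in> states S" for x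
      using S(1) that unfolding ordered_lts_def by (blast dest: reflp_onD transp_onD)+
    have "\<exists>F. finite F \<and> (\<forall>I\<in>F. ideal S I) \<and> ?C v = \<Union>F" if "v \<in> D" for v
    proof (rule less.IH)
      have v: "v \<in> states S" using less.prems that unfolding down_closed_def by blast
      show C: "down_closed S (?C v)"
        using less.prems v trans unfolding down_closed_def by blast
      show "(?C v, D) \<in> {(D, E). down_closed S D \<and> down_closed S E \<and> D \<subset> E}"
        using C less.prems that refl[OF v] by blast
    qed
    then obtain F G where "finite F" "finite G" "\<forall>I\<in>F \<union> G. ideal S I"
      "?C x = \<Union>F" "?C y = \<Union>G"
      using xy(1,2) by (metis (no_types, lifting) Un_iff)
    moreover have "D = ?C x \<union> ?C y"
      using xy(3) by blast
    ultimately show ?thesis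
      by (metis (no_types, lifting) Union_Un_distrib finite_UnI)
  qed
qed

text \<open>Ideals are prime: if some \<open>x\<close> in \<open>J\<close> avoids \<open>K\<close>,
  every \<open>y\<close> in \<open>J\<close> has a common upper bound with \<open>x\<close> in
  \<open>J\<close>; that bound avoids \<open>K\<close> too, so \<open>y\<close> is covered by the
  remaining sets.\<close>

lemma ideal_subset_Union:
  assumes "ideal S J" "finite F" "\<And>K. K \<in> F \<Longrightarrow> down_closed S K" "J \<subseteq> \<Union>F"
  shows "\<exists>K\<in>F. J \<subseteq> K"
  using assms(2,3,4)
proof (induction F)
  case empty
  then show ?case using assms(1) unfolding ideal_def by blast
next
  case (insert K F)
  show ?case
  proof (cases "J \<subseteq> K")
    case False
    then obtain x where x: "x \<in> J" "x \<notin> K" by blast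
    have J: "J \<subseteq> states S" using assms(1) unfolding ideal_def by blast
    have "J \<subseteq> \<Union>F"
    proof
      fix y assume y: "y \<in> J"
      with x obtain z where z: "z \<in> J" "leq S x z" "leq S y z"
        using assms(1) unfolding ideal_def by blast
      have "z \<notin> K"
        using insert.prems(1)[of K] x z(2) J unfolding down_closed_def by blast
      then obtain L where "L \<in> F" "z \<in> L" using insert.prems(2) z(1) by blast
      then show "y \<in> \<Union>F"
        using insert.prems(1)[of L] z(3) y J unfolding down_closed_def by blast
    qed
    then show ?thesis using insert.IH insert.prems(1) by blast
  qed blast
qed

section \<open>Programs for arithmetic and lists\<close>

lemma run_PrimRec:
  assumes "run f ys = Some (F 0)"
    and "\<And>m. m < n \<Longrightarrow> run g (m # F m # ys) = Some (F (Suc m))"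
  shows "run (PrimRec f g) (n # ys) = Some (F n)"
proof -
  have "rec_nat (run f ys) (\<lambda>m r. Option.bind r (\<lambda>v. run g (m # v # ys))) k = Some (F k)"
    if "k \<le> n" for k
    using that by (induction k) (use assms in auto)
  then show ?thesis by simp
qed

lemma run_Mu:
  assumes "\<And>n. run f (n # xs) = Some (F n)" and "F k = 0"
  shows "run (Mu f) xs = Some (LEAST n. F n = 0)"
  using assms by auto

primrec const_prog :: "nat \<Rightarrow> prog" where
  "const_prog 0 = Zero"
| "const_prog (Suc n) = Comp Succ [const_prog n]"

lemma run_const_prog [simp]: "run (const_prog n) xs = Some n"
  by (induction n) auto

definition add_prog :: prog where
  "add_prog = PrimRec (Proj 0) (Comp Succ [Proj 1])"

lemma run_add_prog [simp]: "run add_prog [m, n] = Some (m + n)"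
  unfolding add_prog_def by (rule run_PrimRec) auto

definition mult_prog :: prog where
  "mult_prog = PrimRec Zero (Comp add_prog [Proj 1, Proj 2])"

lemma run_mult_prog [simp]: "run mult_prog [m, n] = Some (m * n)"
  unfolding mult_prog_def by (rule run_PrimRec) auto

definition pred_prog :: prog where
  "pred_prog = PrimRec Zero (Proj 0)"

lemma run_pred_prog [simp]: "run pred_prog [n] = Some (n - 1)"
  unfolding pred_prog_def by (rule run_PrimRec) auto

definition diff_prog :: prog where
  "diff_prog = Comp (PrimRec (Proj 0) (Comp pred_prog [Proj 1])) [Proj 1, Proj 0]"

lemma run_diff_prog [simp]: "run diff_prog [m, n] = Some (m - n)"
proof -
  have "run (PrimRec (Proj 0) (Comp pred_prog [Proj 1])) [n, m] = Some (m - n)"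
    by (rule run_PrimRec) auto
  then show ?thesis
    unfolding diff_prog_def by (simp del: run.simps(5))
qed

definition not_prog :: prog where
  "not_prog = Comp diff_prog [const_prog 1, Proj 0]"

lemma run_not_prog [simp]: "run not_prog [n] = Some (of_bool (n = 0))"
  unfolding not_prog_def by simp

definition or_prog :: prog where
  "or_prog = Comp not_prog [Comp not_prog [add_prog]]"

lemma run_or_prog [simp]: "run or_prog [m, n] = Some (of_bool (m \<noteq> 0 \<or> n \<noteq> 0))"
  unfolding or_prog_def by simp

text \<open>Composition is strict, so both branches are always evaluated and must converge; the test
  only selects a value.\<close>

definition if_prog :: prog where
  "if_prog = Comp add_prog [Comp mult_prog [Comp not_prog [Proj 0], Proj 2],
     Comp mult_prog [Comp not_prog [Comp not_prog [Proj 0]], Proj 1]]"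

lemma run_if_prog [simp]: "run if_prog [b, m, n] = Some (if b \<noteq> 0 then m else n)"
  unfolding if_prog_def by simp

text \<open>The arity \<open>a\<close> counts the parameters of \<open>f\<close> other than the quantified one.\<close>

definition bex_prog :: "nat \<Rightarrow> prog \<Rightarrow> prog" where
  "bex_prog a f = PrimRec Zero (Comp or_prog [Proj 1, Comp f (Proj 0 # map Proj [2..<a + 2])])"

text \<open>\<open>ys\<close> stands for the counter and accumulator that primitive recursion puts
  before the parameters \<open>xs\<close>; it is arbitrary so that the induction can shift elements
  of \<open>xs\<close> into it.\<close>

lemma those_map_run_Proj:
  "those (map (\<lambda>g. run g (ys @ xs)) (map Proj [length ys..<length xs + length ys])) = Some xs"
proof (induction xs arbitrary: ys)
  case (Cons x xs)
  from Cons.IH[of "ys @ [x]"] show ?case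
    by (simp add: upt_conv_Cons del: upt_Suc)
qed simp

lemma run_bex_prog:
  assumes "length xs = a" and "\<And>i. i < n \<Longrightarrow> run f (i # xs) = Some (of_bool (P i))"
  shows "run (bex_prog a f) (n # xs) = Some (of_bool (\<exists>i<n. P i))"
  unfolding bex_prog_def
proof (rule run_PrimRec)
  fix m assume "m < n"
  let ?v = "of_bool (\<exists>i<m. P i) :: nat"
  have "those (map (\<lambda>g. run g (m # ?v # xs)) (map Proj [2..<a + 2])) = Some xs"
    using those_map_run_Proj[of "[m, ?v]" xs] assms(1) by (simp add: numeral_2_eq_2)
  then show "run (Comp or_prog [Proj 1, Comp f (Proj 0 # map Proj [2..<a + 2])]) (m # ?v # xs) =
      Some (of_bool (\<exists>i<Suc m. P i))"
    using assms(2)[OF \<open>m < n\<close>]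
    by (auto simp del: map_map upt_Suc dest: less_Suc_eq[THEN iffD1] intro: less_SucI)
qed simp

section \<open>Arithmetic of the Cantor pairing function\<close>

definition triangle_prog :: prog where
  "triangle_prog = PrimRec Zero (Comp Succ [Comp add_prog [Proj 0, Proj 1]])"

lemma run_triangle_prog [simp]: "run triangle_prog [n] = Some (triangle n)"
  unfolding triangle_prog_def by (rule run_PrimRec) auto

definition pair_prog :: prog where
  "pair_prog = Comp add_prog [Comp triangle_prog [add_prog], Proj 0]"

lemma run_pair_prog [simp]: "run pair_prog [m, n] = Some (prod_encode (m, n))"
  unfolding pair_prog_def by (simp add: prod_encode_def)

text \<open>
  The sum \<open>s\<close> of the components of a pair encoded by \<open>z\<close> is the least \<open>s\<close> with
  \<open>z < triangle (Suc s)\<close>.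
\<close>

definition pair_sum_prog :: prog where
  "pair_sum_prog = Mu (Comp diff_prog
     [Comp Succ [Proj 1], Comp triangle_prog [Comp Succ [Proj 0]]])"

lemma triangle_mono: "m \<le> n \<Longrightarrow> triangle m \<le> triangle n"
  by (rule lift_Suc_mono_le[of triangle]) auto

lemma run_pair_sum_prog [simp]: "run pair_sum_prog [prod_encode (m, n)] = Some (m + n)"
proof -
  let ?F = "\<lambda>s. Suc (prod_encode (m, n)) - triangle (Suc s)"
  have "run pair_sum_prog [prod_encode (m, n)] = Some (LEAST s. ?F s = 0)"
    unfolding pair_sum_prog_def
    by (rule run_Mu[where k = "m + n"]) (auto simp: prod_encode_def)
  also have "(LEAST s. ?F s = 0) = m + n"
  proof (rule Least_equality)
    show "?F (m + n) = 0" by (simp add: prod_encode_def)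
  next
    fix s assume s: "?F s = 0"
    show "m + n \<le> s"
    proof (rule ccontr)
      assume "\<not> m + n \<le> s"
      then have "triangle (Suc s) \<le> triangle (m + n)" by (intro triangle_mono) auto
      with s show False by (simp add: prod_encode_def)
    qed
  qed
  finally show ?thesis .
qed

definition fst_prog :: prog where
  "fst_prog = Comp diff_prog [Proj 0, Comp triangle_prog [pair_sum_prog]]"

definition snd_prog :: prog where
  "snd_prog = Comp diff_prog [pair_sum_prog, fst_prog]"

lemma run_fst_prog [simp]: "run fst_prog [z] = Some (fst (prod_decode z))"
proof -
  obtain m n where "z = prod_encode (m, n)" by (metis prod_decode_inverse surj_pair)
  moreover have "prod_encode (m, n) - triangle (m + n) = m" by (simp add: prod_encode_def)
  ultimately show ?thesis unfolding fst_prog_def by simp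
qed

lemma run_snd_prog [simp]: "run snd_prog [z] = Some (snd (prod_decode z))"
proof -
  obtain m n where "z = prod_encode (m, n)" by (metis prod_decode_inverse surj_pair)
  then show ?thesis unfolding snd_prog_def by simp
qed

section \<open>Access to list codes\<close>

definition drop_code :: "nat \<Rightarrow> nat \<Rightarrow> nat" where
  "drop_code i n = ((\<lambda>n. snd (prod_decode (n - 1))) ^^ i) n"

text \<open>A non-empty list is coded by the successor of a pair of its head and the code of its
  tail, so one iteration takes the tail; 0, the code of \<open>[]\<close>, is a fixed point.\<close>

lemma list_decode_drop_code: "list_decode (drop_code i n) = drop i (list_decode n)"
proof (induction i)
  case (Suc i)
  have "list_decode (snd (prod_decode (k - 1))) = tl (list_decode k)" for k
  proof (cases k)
    case 0
    then show ?thesis by (simp add: prod_decode_def prod_decode_aux.simps)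
  qed (simp split: prod.split)
  then show ?case
    using Suc by (simp add: drop_code_def drop_Suc tl_drop)
qed (simp add: drop_code_def)

definition nth_code :: "nat \<Rightarrow> nat \<Rightarrow> nat \<Rightarrow> nat" where
  "nth_code d n i = (if i < length (list_decode n) then list_decode n ! i else d)"

lemma nth_code_eq:
  "nth_code d n i =
     (if drop_code i n \<noteq> 0 then fst (prod_decode (drop_code i n - 1)) else d)"
proof (cases "drop_code i n")
  case 0
  then have "drop i (list_decode n) = []" using list_decode_drop_code[of i n] by simp
  with 0 show ?thesis by (simp add: nth_code_def)
next
  case (Suc k)
  then have dr: "drop i (list_decode n) = list_decode (Suc k)"
    using list_decode_drop_code[of i n] by simp
  then have "i < length (list_decode n)"
    by (metis drop_eq_Nil2 leI list.distinct(1) list_decode.simps(2) split_def)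
  moreover from dr this have "list_decode n ! i = fst (prod_decode k)"
    by (metis (no_types, lifting) hd_drop_conv_nth list.sel(1) list_decode.simps(2) split_def)
  ultimately show ?thesis using Suc by (simp add: nth_code_def)
qed

definition drop_prog :: prog where
  "drop_prog = PrimRec (Proj 0) (Comp snd_prog [Comp pred_prog [Proj 1]])"

lemma run_drop_prog [simp]: "run drop_prog [i, n] = Some (drop_code i n)"
  unfolding drop_prog_def drop_code_def by (rule run_PrimRec) auto

definition nth_prog :: prog where
  "nth_prog = Comp if_prog [Comp drop_prog [Proj 2, Proj 1],
     Comp fst_prog [Comp pred_prog [Comp drop_prog [Proj 2, Proj 1]]], Proj 0]"

lemma run_nth_prog [simp]: "run nth_prog [d, n, i] = Some (nth_code d n i)"
  unfolding nth_prog_def nth_code_eq by simp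

text \<open>The code of a tail is smaller than that of the list. Bounded search over a list can
  therefore run up to its code, without computing the length.\<close>

lemma length_list_decode_le: "length (list_decode n) \<le> n"
proof (induction n rule: list_decode.induct)
  case (2 n)
  obtain x y where xy: "prod_decode n = (x, y)" by fastforce
  then have "y \<le> n" by (metis le_prod_encode_2 prod_decode_inverse)
  with 2[of x y] xy show ?case by simp
qed simp

lemma set_list_decode_nth_code:
  "c \<in> set (list_decode n) \<Longrightarrow> \<exists>i<n. nth_code d n i = c"
  by (metis in_set_conv_nth length_list_decode_le less_le_trans nth_code_def)

lemma nth_code_in: "nth_code d n i \<in> insert d (set (list_decode n))"
  by (simp add: nth_code_def)

section \<open>The decision procedure\<close>

text \<open>
  A witness \<open>w\<close> is read as a list in two ways: as the successor indices of a path from \<open>c0\<close>,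
  and as encodings of ideals. An invalid encoding is replaced by one of \<open>Down {x\<^sub>0}\<close>, so that
  \<open>ps\<close> and \<open>pp\<close> are only run on encodings of ideals.
\<close>

definition walk_prog :: "prog \<Rightarrow> nat \<Rightarrow> prog" where
  "walk_prog p c0 = PrimRec (const_prog c0)
     (Comp nth_prog [Proj 1, Comp p [Proj 1], Comp nth_prog [Zero, Proj 2, Proj 0]])"

text \<open>The order on states is tested through inclusion of the principal ideals computed by
  \<open>pd\<close>.\<close>

definition reach_prog :: "prog \<Rightarrow> prog \<Rightarrow> prog \<Rightarrow> nat \<Rightarrow> prog" where
  "reach_prog pd ps p c0 =
     Comp (bex_prog 2 (Comp ps [Comp pd [Proj 2], Comp pd [Comp (walk_prog p c0) [Proj 0, Proj 1]]]))
       [Comp Succ [Proj 0], Proj 0, Proj 1]"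

definition ideal_prog :: "prog \<Rightarrow> prog \<Rightarrow> nat \<Rightarrow> prog" where
  "ideal_prog pr pd c0 =
     Comp if_prog [Comp pr [Comp nth_prog [Comp pd [const_prog c0], Proj 1, Proj 0]],
       Comp nth_prog [Comp pd [const_prog c0], Proj 1, Proj 0], Comp pd [const_prog c0]]"

definition included_prog :: "prog \<Rightarrow> prog \<Rightarrow> prog \<Rightarrow> nat \<Rightarrow> prog" where
  "included_prog pr pd ps c0 =
     Comp (bex_prog 2 (Comp ps [Proj 1, Comp (ideal_prog pr pd c0) [Proj 0, Proj 2]]))
       [Comp Succ [Proj 1], Proj 0, Proj 1]"

text \<open>The outer search runs over the ideals given by \<open>w\<close>, the inner one over the
  components that \<open>pp\<close> returns for such an ideal. This output is passed twice, as
  search bound and as list code.\<close>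

definition escape_prog :: "prog \<Rightarrow> prog \<Rightarrow> prog \<Rightarrow> prog \<Rightarrow> nat \<Rightarrow> prog" where
  "escape_prog pr pd ps pp c0 =
     Comp (bex_prog 1 (Comp (bex_prog 2 (Comp not_prog [Comp (included_prog pr pd ps c0)
           [Comp nth_prog [Comp pd [const_prog c0], Proj 1, Proj 0], Proj 2]]))
         [Comp pp [ideal_prog pr pd c0], Comp pp [ideal_prog pr pd c0], Proj 1]))
       [Comp Succ [Proj 0], Proj 0]"

text \<open>Zero signals success, as \<open>Mu\<close> requires: the value is 0 iff the first
  argument is a witness of either kind for the second.\<close>

definition search_prog :: "prog \<Rightarrow> prog \<Rightarrow> prog \<Rightarrow> prog \<Rightarrow> prog \<Rightarrow> nat \<Rightarrow> prog" where
  "search_prog pr pd ps pp p c0 =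
     Comp not_prog [Comp or_prog [reach_prog pd ps p c0, Comp not_prog [Comp or_prog
       [Comp (escape_prog pr pd ps pp c0) [Proj 0], Comp (included_prog pr pd ps c0) [Comp pd [Proj 1], Proj 0]]]]]"

definition cover_prog :: "prog \<Rightarrow> prog \<Rightarrow> prog \<Rightarrow> prog \<Rightarrow> prog \<Rightarrow> nat \<Rightarrow> prog" where
  "cover_prog pr pd ps pp p c0 =
     Comp (reach_prog pd ps p c0) [Mu (search_prog pr pd ps pp p c0), Proj 0]"

locale effective_cover_wsts =
  fixes S :: "('x, 'a) lts" and eX eI and pr pd ps pp p :: prog and c0 :: nat
  assumes wsts: "cover_wsts S"
    and effective: "ideally_effective_by S eX eI pr pd ps pp"
    and post: "Post_computable_by S eX p"
    and c0: "eX c0 = Some (init S)"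
begin

section \<open>Order, reachability and closure properties of the cover\<close>

lemma ordered: "ordered_lts S"
  using wsts unfolding cover_wsts_def by blast

lemma leq_refl: "x \<in> states S \<Longrightarrow> leq S x x"
  using ordered unfolding ordered_lts_def by (blast dest: reflp_onD)

lemma leq_trans:
  "x \<in> states S \<Longrightarrow> y \<in> states S \<Longrightarrow> z \<in> states S \<Longrightarrow> leq S x y \<Longrightarrow> leq S y z \<Longrightarrow> leq S x z"
  using ordered unfolding ordered_lts_def by (blast dest: transp_onD)

lemma step_states: "step S x y \<Longrightarrow> x \<in> states S \<and> y \<in> states S"
  using ordered unfolding ordered_lts_def step_def by blast

lemma init_state: "init S \<in> states S"
  using ordered unfolding ordered_lts_def by blast

lemma Post_star_states: "y \<in> Post_star S (init S) \<Longrightarrow> y \<in> states S"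
  unfolding Post_star_def mem_Collect_eq
  by (induction rule: rtranclp_induct) (auto simp: init_state step_states)

text \<open>Membership becomes inclusion of a principal ideal, which \<open>ps\<close> decides when
  \<open>D\<close> is an ideal.\<close>

lemma Down_subset_iff:
  assumes "y \<in> states S" "down_closed S D"
  shows "Down S {y} \<subseteq> D \<longleftrightarrow> y \<in> D"
  using assms leq_refl unfolding Down_def down_closed_def by blast

lemma down_closed_Down: "D \<subseteq> states S \<Longrightarrow> down_closed S (Down S D)"
  unfolding down_closed_def Down_def by (blast intro: leq_trans)

lemma init_Cover: "init S \<in> Cover S"
  unfolding Cover_def Down_def Post_star_def using init_state leq_refl by blast

text \<open>Cover-monotonicity is applied at a reachable state above \<open>x\<close>; by
  reflexivity that state is itself in the cover.\<close>

lemma Post_Cover: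
  assumes "x \<in> Cover S" "step S x x'"
  shows "x' \<in> Cover S"
proof -
  from assms(1) obtain y where y: "y \<in> Post_star S (init S)" "leq S x y"
    unfolding Cover_def Down_def by blast
  then have "y \<in> Cover S"
    using Post_star_states leq_refl unfolding Cover_def Down_def by blast
  then obtain y' where "(step S)\<^sup>*\<^sup>* y y'" "leq S x' y'"
    using y assms(2) step_states[OF assms(2)] wsts
    unfolding cover_wsts_def cover_monotone_def by blast
  with y(1) show ?thesis
    using step_states[OF assms(2)] unfolding Cover_def Down_def Post_star_def
    by (auto intro: rtranclp_trans)
qed

lemma Cover_subset:
  assumes "down_closed S D" "init S \<in> D" "\<And>x y. x \<in> D \<Longrightarrow> step S x y \<Longrightarrow> y \<in> D"
  shows "Cover S \<subseteq> D"
proof -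
  have "y \<in> D" if "y \<in> Post_star S (init S)" for y
    using that unfolding Post_star_def mem_Collect_eq
    by (induction rule: rtranclp_induct) (use assms in auto)
  then show ?thesis
    using assms(1) unfolding Cover_def Down_def down_closed_def by blast
qed

section \<open>Behaviour of the given programs\<close>

lemma code_state: "eX c = Some x \<Longrightarrow> x \<in> states S"
  using effective unfolding ideally_effective_by_def by (blast intro: ranI)

lemma code_ideal: "eI i = Some I \<Longrightarrow> ideal S I"
  using effective unfolding ideally_effective_by_def by (blast intro: ranI)

lemma ideal_code: "ideal S I \<Longrightarrow> \<exists>i. eI i = Some I"
  using effective unfolding ideally_effective_by_def ran_def by blast

lemma run_pr: "run pr [i] = Some (of_bool (eI i \<noteq> None))"
  using effective unfolding ideally_effective_by_def by (auto simp: dom_def)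

lemma run_pd:
  assumes "eX c = Some x"
  obtains i where "run pd [c] = Some i" "eI i = Some (Down S {x})"
  using assms effective unfolding ideally_effective_by_def by blast

lemma run_ps:
  "eI i = Some I \<Longrightarrow> eI j = Some J \<Longrightarrow> run ps [i, j] = Some (of_bool (I \<subseteq> J))"
  using effective unfolding ideally_effective_by_def by blast

lemma run_pp:
  assumes "eI i = Some I"
  obtains n F where "run pp [i] = Some n" "encodes_set eI n F" "Down S (\<Union>x\<in>I. Post S x) = \<Union>F"
  using assms effective unfolding ideally_effective_by_def by blast

lemma run_p:
  assumes "eX c = Some x"
  obtains n where "run p [c] = Some n" "encodes_set eX n (Post S x)"
  using assms post unfolding Post_computable_by_def by blast

section \<open>Finite paths driven by successor indices\<close>

primrec walk :: "(nat \<Rightarrow> nat) \<Rightarrow> nat \<Rightarrow> nat" where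
  "walk f 0 = c0"
| "walk f (Suc k) = nth_code (walk f k) (the (run p [walk f k])) (f k)"

lemma walk_cong: "(\<And>i. i < k \<Longrightarrow> f i = g i) \<Longrightarrow> walk f k = walk g k"
  by (induction k) auto

text \<open>An index past the end makes the walk stay where it is; any other index selects a code of
  a successor. As only codes of states occur, \<open>p\<close> always converges and
  \<open>the\<close> in \<open>walk\<close> is harmless.\<close>

lemma walk_reachable: "\<exists>x. eX (walk f k) = Some x \<and> x \<in> Post_star S (init S)"
proof (induction k)
  case 0
  then show ?case using c0 by (simp add: Post_star_def)
next
  case (Suc k)
  then obtain x where x: "eX (walk f k) = Some x" "x \<in> Post_star S (init S)" by blast
  obtain n where n: "run p [walk f k] = Some n" "encodes_set eX n (Post S x)"
    using run_p[OF x(1)] .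
  show ?case
  proof (cases "walk f (Suc k) = walk f k")
    case False
    then have "walk f (Suc k) \<in> set (list_decode n)"
      using nth_code_in[of "walk f k" n "f k"] n(1) by auto
    then obtain y where "y \<in> Post S x" "eX (walk f (Suc k)) = Some y"
      using n(2) unfolding encodes_set_def by (metis imageE imageI)
    with x(2) show ?thesis
      unfolding Post_star_def Post_def by (auto intro: rtranclp.rtrancl_into_rtrancl)
  qed (use x in metis)
qed

lemma reachable_walk:
  assumes "y \<in> Post_star S (init S)"
  shows "\<exists>f k. eX (walk f k) = Some y"
  using assms unfolding Post_star_def mem_Collect_eq
proof (induction rule: rtranclp_induct)
  case base
  have "eX (walk id 0) = Some (init S)" using c0 by simp
  then show ?case by blast
next
  case (step y z)
  then obtain f k where fk: "eX (walk f k) = Some y" by blast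
  obtain n where n: "run p [walk f k] = Some n" "encodes_set eX n (Post S y)"
    using run_p[OF fk] .
  have "z \<in> Post S y" using step.hyps(2) by (simp add: Post_def)
  then obtain c where c: "c \<in> set (list_decode n)" "eX c = Some z"
    using n(2) unfolding encodes_set_def by (metis imageE imageI)
  obtain i where i: "nth_code (walk f k) n i = c"
    using set_list_decode_nth_code[OF c(1)] by blast
  have "walk (f(k := i)) k = walk f k" by (rule walk_cong) auto
  then have "walk (f(k := i)) (Suc k) = c" using n(1) i by simp
  with c(2) show ?case by blast
qed

lemma run_walk_prog:
  "run (walk_prog p c0) [k, w] = Some (walk (nth_code 0 w) k)"
  unfolding walk_prog_def
proof (rule run_PrimRec)
  fix m
  obtain x where "eX (walk (nth_code 0 w) m) = Some x" using walk_reachable by blast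
  then obtain n where "run p [walk (nth_code 0 w) m] = Some n" by (rule run_p)
  then show "run (Comp nth_prog [Proj 1, Comp p [Proj 1], Comp nth_prog [Zero, Proj 2, Proj 0]])
      (m # walk (nth_code 0 w) m # [w]) = Some (walk (nth_code 0 w) (Suc m))"
    by simp
qed simp

section \<open>Witnesses for coverability\<close>

definition reach_witness :: "nat \<Rightarrow> 'x \<Rightarrow> bool" where
  "reach_witness w y \<longleftrightarrow> (\<exists>k<Suc w. leq S y (the (eX (walk (nth_code 0 w) k))))"

lemma reach_witness_Cover:
  "y \<in> states S \<Longrightarrow> reach_witness w y \<Longrightarrow> y \<in> Cover S"
  unfolding reach_witness_def Cover_def Down_def
  using walk_reachable[of "nth_code 0 w"] by (auto dest: spec) (metis option.sel)

lemma Cover_reach_witness: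
  assumes "y \<in> Cover S"
  shows "\<exists>w. reach_witness w y"
proof -
  from assms obtain z where z: "z \<in> Post_star S (init S)" "leq S y z"
    unfolding Cover_def Down_def by blast
  then obtain f k where fk: "eX (walk f k) = Some z" using reachable_walk by blast
  define w where "w = list_encode (map f [0..<k])"
  have w: "list_decode w = map f [0..<k]" by (simp add: w_def)
  \<comment> \<open>The code is at least as large as the list is long, hence the bound on
    \<open>k\<close> in \<open>reach_witness\<close> loses no path.\<close>
  then have "k \<le> w" using length_list_decode_le[of w] by simp
  moreover have "walk (nth_code 0 w) k = walk f k"
    by (rule walk_cong) (simp add: nth_code_def w)
  ultimately show ?thesis
    using fk z(2) unfolding reach_witness_def by (metis less_Suc_eq_le option.sel)
qed

lemma run_reach_prog:
  assumes "eX c = Some y"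
  shows "run (reach_prog pd ps p c0) [w, c] = Some (of_bool (reach_witness w y))"
proof -
  let ?f = "Comp ps [Comp pd [Proj 2], Comp pd [Comp (walk_prog p c0) [Proj 0, Proj 1]]]"
  have "run ?f [k, w, c] = Some (of_bool (leq S y (the (eX (walk (nth_code 0 w) k)))))" for k
  proof -
    obtain x where x: "eX (walk (nth_code 0 w) k) = Some x" using walk_reachable by blast
    from run_pd[OF x] obtain i where i: "run pd [walk (nth_code 0 w) k] = Some i"
      "eI i = Some (Down S {x})" .
    from run_pd[OF assms] obtain j where j: "run pd [c] = Some j"
      "eI j = Some (Down S {y})" .
    have "Down S {y} \<subseteq> Down S {x} \<longleftrightarrow> y \<in> Down S {x}"
      using code_state[OF x] code_state[OF assms]
      by (intro Down_subset_iff down_closed_Down) (auto simp: Down_def)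
    also have "\<dots> \<longleftrightarrow> leq S y x"
      using code_state[OF assms] by (auto simp: Down_def)
    finally show ?thesis
      using i j x run_ps[OF j(2) i(2)] by (simp add: run_walk_prog)
  qed
  then have "run (bex_prog 2 ?f) [Suc w, w, c] = Some (of_bool (reach_witness w y))"
    unfolding reach_witness_def by (intro run_bex_prog) auto
  then show ?thesis unfolding reach_prog_def by simp
qed

section \<open>Finite unions of ideals given by numbers\<close>

definition init_ideal :: nat where
  "init_ideal = the (run pd [c0])"

lemma init_ideal: "run pd [c0] = Some init_ideal" "eI init_ideal = Some (Down S {init S})"
  by (rule run_pd[OF c0], simp add: init_ideal_def)+

text \<open>\<open>nth_code\<close> returns its default at index \<open>w\<close>, so \<open>Down {x\<^sub>0}\<close> is always among the ideals
  with index at most \<open>w\<close>.\<close>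

definition ideal_at :: "nat \<Rightarrow> nat \<Rightarrow> nat" where
  "ideal_at w i = (let c = nth_code init_ideal w i in if eI c \<noteq> None then c else init_ideal)"

definition ideals :: "nat \<Rightarrow> 'x set set" where
  "ideals w = {I. \<exists>i<Suc w. eI (ideal_at w i) = Some I}"

lemma ideal_at: "\<exists>I. eI (ideal_at w i) = Some I"
  unfolding ideal_at_def Let_def using init_ideal(2) by auto

lemma ideals_image: "ideals w = (\<lambda>i. the (eI (ideal_at w i))) ` {..<Suc w}"
  unfolding ideals_def using ideal_at by (force simp: image_iff)

lemma finite_ideals: "finite (ideals w)"
  unfolding ideals_image by blast

lemma ideals_ideal: "I \<in> ideals w \<Longrightarrow> ideal S I"
  unfolding ideals_def using code_ideal by blast

lemma init_ideals: "Down S {init S} \<in> ideals w"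
proof -
  have "ideal_at w w = init_ideal"
    using length_list_decode_le[of w] by (auto simp: ideal_at_def nth_code_def)
  then show ?thesis unfolding ideals_def using init_ideal(2) by (auto intro: exI[of _ w])
qed

text \<open>Every finite set of ideals is realised by a number, up to the additional ideal
  \<open>Down S {init S}\<close>. The latter is absorbed when the union is the cover.\<close>

lemma ideals_encode:
  assumes "\<And>c. c \<in> set cs \<Longrightarrow> eI c \<noteq> None"
  shows "ideals (list_encode cs) = insert (Down S {init S}) (the ` eI ` set cs)"
proof
  show "ideals (list_encode cs) \<subseteq> insert (Down S {init S}) (the ` eI ` set cs)"
  proof
    fix I assume "I \<in> ideals (list_encode cs)"
    then obtain i where i: "eI (ideal_at (list_encode cs) i) = Some I"
      unfolding ideals_def by blast
    have "ideal_at (list_encode cs) i \<in> insert init_ideal (set cs)"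
      using nth_code_in[of init_ideal "list_encode cs" i] by (auto simp: ideal_at_def Let_def)
    then show "I \<in> insert (Down S {init S}) (the ` eI ` set cs)"
      using i init_ideal(2) by (metis image_eqI insert_iff option.sel)
  qed
  have "the (eI c) \<in> ideals (list_encode cs)" if c: "c \<in> set cs" for c
  proof -
    from c obtain i where i: "i < list_encode cs" "nth_code init_ideal (list_encode cs) i = c"
      using set_list_decode_nth_code[of c "list_encode cs" init_ideal] by auto
    then have "ideal_at (list_encode cs) i = c"
      using assms[OF c] by (simp add: ideal_at_def Let_def)
    then show ?thesis
      unfolding ideals_image using i(1) by (intro image_eqI[of _ _ i]) auto
  qed
  then show "insert (Down S {init S}) (the ` eI ` set cs) \<subseteq> ideals (list_encode cs)"
    using init_ideals by auto
qed

lemma run_ideal_prog: "run (ideal_prog pr pd c0) [i, w] = Some (ideal_at w i)"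
  unfolding ideal_prog_def ideal_at_def by (simp add: init_ideal(1) run_pr Let_def)

lemma run_included_prog:
  assumes "eI j = Some J"
  shows "run (included_prog pr pd ps c0) [j, w] = Some (of_bool (\<exists>I\<in>ideals w. J \<subseteq> I))"
proof -
  let ?f = "Comp ps [Proj 1, Comp (ideal_prog pr pd c0) [Proj 0, Proj 2]]"
  have "run ?f [i, j, w] = Some (of_bool (J \<subseteq> the (eI (ideal_at w i))))" for i
  proof -
    obtain I where "eI (ideal_at w i) = Some I" using ideal_at by blast
    then show ?thesis using run_ps[OF assms] by (simp add: run_ideal_prog)
  qed
  then have "run (bex_prog 2 ?f) [Suc w, j, w] =
      Some (of_bool (\<exists>i<Suc w. J \<subseteq> the (eI (ideal_at w i))))"
    by (intro run_bex_prog) auto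
  then show ?thesis
    unfolding included_prog_def ideals_image by simp
qed

section \<open>Deciding invariance\<close>

definition invariant :: "nat \<Rightarrow> bool" where
  "invariant w \<longleftrightarrow> (\<forall>x y. x \<in> \<Union>(ideals w) \<longrightarrow> step S x y \<longrightarrow> y \<in> \<Union>(ideals w))"

lemma down_closed_Union_ideals_code: "down_closed S (\<Union>(ideals w))"
  using ideals_ideal[of _ w] unfolding ideal_iff down_closed_def by blast

text \<open>The union is downward closed, so closing the successors downwards adds no requirement.
  This turns closure under steps into inclusions about the output of \<open>pp\<close>.\<close>

lemma down_Post_subset_iff:
  assumes "ideal S I"
  shows "Down S (\<Union>x\<in>I. Post S x) \<subseteq> \<Union>(ideals w) \<longleftrightarrow>
    (\<forall>x\<in>I. \<forall>y. step S x y \<longrightarrow> y \<in> \<Union>(ideals w))"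
proof
  assume L: "Down S (\<Union>x\<in>I. Post S x) \<subseteq> \<Union>(ideals w)"
  have "y \<in> Down S (\<Union>x\<in>I. Post S x)" if "x \<in> I" "step S x y" for x y
    using that step_states[OF that(2)] leq_refl unfolding Down_def Post_def by blast
  with L show "\<forall>x\<in>I. \<forall>y. step S x y \<longrightarrow> y \<in> \<Union>(ideals w)" by blast
next
  assume "\<forall>x\<in>I. \<forall>y. step S x y \<longrightarrow> y \<in> \<Union>(ideals w)"
  then show "Down S (\<Union>x\<in>I. Post S x) \<subseteq> \<Union>(ideals w)"
    using down_closed_Union_ideals_code[of w]
    unfolding Down_def Post_def down_closed_def by blast
qed

lemma run_escape_prog:
  "run (escape_prog pr pd ps pp c0) [w] = Some (of_bool (\<not> invariant w))"
proof -
  let ?g = "Comp not_prog [Comp (included_prog pr pd ps c0)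
    [Comp nth_prog [Comp pd [const_prog c0], Proj 1, Proj 0], Proj 2]]"
  let ?f = "Comp (bex_prog 2 ?g)
    [Comp pp [ideal_prog pr pd c0], Comp pp [ideal_prog pr pd c0], Proj 1]"
  let ?Q = "\<lambda>I. \<forall>x\<in>I. \<forall>y. step S x y \<longrightarrow> y \<in> \<Union>(ideals w)"
  have "run ?f [i, w] = Some (of_bool (\<not> ?Q (the (eI (ideal_at w i)))))" for i
  proof -
    obtain I where I: "eI (ideal_at w i) = Some I" using ideal_at by blast
    from run_pp[OF I] obtain n F where nF: "run pp [ideal_at w i] = Some n" "encodes_set eI n F"
      "Down S (\<Union>x\<in>I. Post S x) = \<Union>F" .
    let ?J = "\<lambda>j. the (eI (nth_code init_ideal n j))"
    \<comment> \<open>Entries past the end of the list default to \<open>init_ideal\<close>, so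
      every index yields the code of an ideal.\<close>
    have J: "eI (nth_code init_ideal n j) = Some (?J j) \<and> ?J j \<in> insert (Down S {init S}) F" for j
    proof (cases "nth_code init_ideal n j = init_ideal")
      case False
      then have "nth_code init_ideal n j \<in> set (list_decode n)"
        using nth_code_in[of init_ideal n j] by simp
      then have "eI (nth_code init_ideal n j) \<in> Some ` F"
        using nF(2) unfolding encodes_set_def by blast
      then show ?thesis by auto
    qed (simp add: init_ideal(2))
    have "run (bex_prog 2 ?g) [n, n, w] =
        Some (of_bool (\<exists>j<n. \<not> (\<exists>I\<in>ideals w. ?J j \<subseteq> I)))"
    proof (rule run_bex_prog)
      fix j
      show "run ?g [j, n, w] = Some (of_bool (\<not> (\<exists>I\<in>ideals w. ?J j \<subseteq> I)))"
        using run_included_prog[OF conjunct1[OF J[of j]], of w] by (simp add: init_ideal(1))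
    qed simp
    \<comment> \<open>Default entries do not matter: \<open>Down S {init S}\<close> is one of the
      ideals of \<open>w\<close>, so it never escapes. The bound \<open>n\<close> reaches every list
      entry since a code bounds the length.\<close>
    also have "(\<exists>j<n. \<not> (\<exists>I\<in>ideals w. ?J j \<subseteq> I)) \<longleftrightarrow> (\<exists>J\<in>F. \<not> (\<exists>I\<in>ideals w. J \<subseteq> I))"
    proof
      assume "\<exists>j<n. \<not> (\<exists>I\<in>ideals w. ?J j \<subseteq> I)"
      then show "\<exists>J\<in>F. \<not> (\<exists>I\<in>ideals w. J \<subseteq> I)"
        using J init_ideals[of w] by (metis insertE order_refl)
    next
      assume "\<exists>J\<in>F. \<not> (\<exists>I\<in>ideals w. J \<subseteq> I)"
      then obtain K where K: "K \<in> F" "\<not> (\<exists>I\<in>ideals w. K \<subseteq> I)" by blast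
      then obtain c where c: "c \<in> set (list_decode n)" "eI c = Some K"
        using nF(2) unfolding encodes_set_def by (metis imageE imageI)
      obtain j where "j < n" "nth_code init_ideal n j = c"
        using set_list_decode_nth_code[OF c(1)] by blast
      with K c(2) show "\<exists>j<n. \<not> (\<exists>I\<in>ideals w. ?J j \<subseteq> I)"
        by (metis option.sel)
    qed
    \<comment> \<open>By primality, a component lies in the union iff it lies in a single
      member.\<close>
    also have "\<dots> \<longleftrightarrow> \<not> (\<Union>F \<subseteq> \<Union>(ideals w))"
    proof -
      have "(\<exists>I\<in>ideals w. J \<subseteq> I) \<longleftrightarrow> J \<subseteq> \<Union>(ideals w)" if "J \<in> F" for J
      proof -
        from that have "Some J \<in> eI ` set (list_decode n)"
          using nF(2) unfolding encodes_set_def by blast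
        then have "ideal S J" using code_ideal by (metis imageE)
        then have "\<exists>I\<in>ideals w. J \<subseteq> I" if "J \<subseteq> \<Union>(ideals w)"
          using that ideals_ideal[of _ w]
          by (intro ideal_subset_Union[OF _ finite_ideals]) (auto simp: ideal_iff)
        then show ?thesis by blast
      qed
      then show ?thesis by (auto simp: Sup_le_iff)
    qed
    also have "\<dots> \<longleftrightarrow> \<not> ?Q I"
      using down_Post_subset_iff[OF code_ideal[OF I]] nF(3) by simp
    finally show ?thesis using I nF(1) by (simp add: run_ideal_prog)
  qed
  then have "run (bex_prog 1 ?f) [Suc w, w] =
      Some (of_bool (\<exists>i<Suc w. \<not> ?Q (the (eI (ideal_at w i)))))"
    by (intro run_bex_prog) auto
  moreover have "(\<exists>i<Suc w. \<not> ?Q (the (eI (ideal_at w i)))) \<longleftrightarrow> (\<exists>I\<in>ideals w. \<not> ?Q I)"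
    unfolding ideals_image by blast
  moreover have "\<dots> \<longleftrightarrow> \<not> invariant w"
    unfolding invariant_def by blast
  ultimately show ?thesis unfolding escape_prog_def by simp
qed

section \<open>Invariants as witnesses against coverability\<close>

definition invariant_witness :: "nat \<Rightarrow> 'x \<Rightarrow> bool" where
  "invariant_witness w y \<longleftrightarrow> invariant w \<and> y \<notin> \<Union>(ideals w)"

lemma invariant_witness_Cover:
  assumes "invariant_witness w y"
  shows "y \<notin> Cover S"
proof -
  have "init S \<in> \<Union>(ideals w)"
    using init_ideals[of w] init_state leq_refl unfolding Down_def by blast
  then have "Cover S \<subseteq> \<Union>(ideals w)"
    using assms down_closed_Union_ideals_code unfolding invariant_witness_def invariant_def
    by (intro Cover_subset) blast+
  with assms show ?thesis unfolding invariant_witness_def by blast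
qed

lemma down_closed_Cover: "down_closed S (Cover S)"
  unfolding Cover_def using Post_star_states by (intro down_closed_Down) blast

text \<open>The cover itself serves as the invariant: it splits into finitely many ideals, and a
  list of codes for them is the witness.\<close>

lemma Cover_invariant_witness:
  assumes "y \<notin> Cover S"
  shows "\<exists>w. invariant_witness w y"
proof -
  obtain F where F: "finite F" "\<And>I. I \<in> F \<Longrightarrow> ideal S I" "Cover S = \<Union>F"
    using down_closed_Union_ideals[OF ordered _ down_closed_Cover] wsts
    unfolding cover_wsts_def by blast
  have "\<exists>g. \<forall>I\<in>F. eI (g I) = Some I"
    using F(2) ideal_code by metis
  then obtain g where g: "\<And>I. I \<in> F \<Longrightarrow> eI (g I) = Some I" by blast
  obtain Is where Is: "set Is = F" using F(1) finite_list by blast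
  have "ideals (list_encode (map g Is)) = insert (Down S {init S}) F"
    using g Is by (subst ideals_encode) (auto simp: image_image)
  moreover have "Down S {init S} \<subseteq> Cover S"
    using init_Cover init_state down_closed_Cover unfolding down_closed_def Down_def by blast
  ultimately have "\<Union>(ideals (list_encode (map g Is))) = Cover S"
    using F(3) by auto
  then show ?thesis
    using assms Post_Cover unfolding invariant_witness_def invariant_def by metis
qed

section \<open>Correctness of the search\<close>

lemma run_search_prog:
  assumes "eX c = Some y"
  shows "run (search_prog pr pd ps pp p c0) [w, c] =
    Some (of_bool (\<not> (reach_witness w y \<or> invariant_witness w y)))"
proof -
  from run_pd[OF assms] obtain j where j: "run pd [c] = Some j" "eI j = Some (Down S {y})" .
  have "Down S {y} \<subseteq> I \<longleftrightarrow> y \<in> I" if "I \<in> ideals w" for I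
    using ideals_ideal[OF that] code_state[OF assms]
    by (intro Down_subset_iff) (simp_all add: ideal_iff)
  then have "(\<exists>I\<in>ideals w. Down S {y} \<subseteq> I) \<longleftrightarrow> y \<in> \<Union>(ideals w)"
    by simp
  then have "run (included_prog pr pd ps c0) [j, w] = Some (of_bool (y \<in> \<Union>(ideals w)))"
    using run_included_prog[OF j(2)] by simp
  then show ?thesis
    using run_reach_prog[OF assms, of w] run_escape_prog[of w] j(1)
    unfolding search_prog_def invariant_witness_def by (simp del: Union_iff)
qed

lemma coverability_decidable_by_cover_prog:
  "coverability_decidable_by S eX (cover_prog pr pd ps pp p c0)"
  unfolding coverability_decidable_by_def Cover_def[symmetric]
proof (intro allI impI)
  fix c y assume c: "eX c = Some y"
  let ?F = "\<lambda>w. of_bool (\<not> (reach_witness w y \<or> invariant_witness w y)) :: nat"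
  \<comment> \<open>The search terminates: a path is found if \<open>y\<close> is in the cover, an
    invariant otherwise.\<close>
  obtain w where w: "?F w = 0"
    using Cover_reach_witness Cover_invariant_witness by fastforce
  define v where "v = (LEAST w. ?F w = 0)"
  have "?F v = 0" unfolding v_def using w by (rule LeastI)
  then have "reach_witness v y \<or> invariant_witness v y" by simp
  \<comment> \<open>The two kinds of witnesses exclude each other by soundness, so the kind of the
    least witness settles coverability.\<close>
  then have "reach_witness v y \<longleftrightarrow> y \<in> Cover S"
    using reach_witness_Cover[OF code_state[OF c]] invariant_witness_Cover by blast
  moreover have "run (Mu (search_prog pr pd ps pp p c0)) [c] = Some v"
    unfolding v_def using run_search_prog[OF c] w by (rule run_Mu)
  ultimately show "run (cover_prog pr pd ps pp p c0) [c] = Some (of_bool (y \<in> Cover S))"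
    using run_reach_prog[OF c, of v] unfolding cover_prog_def by (simp del: run.simps(6))
qed

end

section \<open>Computing the decision procedure\<close>

text \<open>\<open>A e\<close> is the argument list describing the environment \<open>e\<close>. One
  program has to serve all environments, which gives the uniformity.\<close>

definition computable_from :: "('e \<Rightarrow> nat list) \<Rightarrow> ('e \<Rightarrow> nat) \<Rightarrow> bool" where
  "computable_from A f \<longleftrightarrow> (\<exists>t. \<forall>e. run t (A e) = Some (f e))"

named_theorems computable_intros

lemma computable_from_const [computable_intros]: "computable_from A (\<lambda>e. n)"
  unfolding computable_from_def by (rule exI[of _ "const_prog n"]) simp

lemma computable_from_comp:
  assumes "computable_from A f" "\<And>n. run t [n] = Some (F n)"
  shows "computable_from A (\<lambda>e. F (f e))"
proof -
  from assms(1) obtain u where "\<And>e. run u (A e) = Some (f e)"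
    unfolding computable_from_def by blast
  then have "\<forall>e. run (Comp t [u]) (A e) = Some (F (f e))" using assms(2) by simp
  then show ?thesis unfolding computable_from_def by blast
qed

lemma computable_from_Suc [computable_intros]:
  "computable_from A f \<Longrightarrow> computable_from A (\<lambda>e. Suc (f e))"
  by (rule computable_from_comp[of A f Succ]) auto

lemma computable_from_pair [computable_intros]:
  assumes "computable_from A f" "computable_from A g"
  shows "computable_from A (\<lambda>e. prod_encode (f e, g e))"
proof -
  from assms obtain t u where "\<And>e. run t (A e) = Some (f e)" "\<And>e. run u (A e) = Some (g e)"
    unfolding computable_from_def by blast
  then have "\<forall>e. run (Comp pair_prog [t, u]) (A e) = Some (prod_encode (f e, g e))" by simp
  then show ?thesis unfolding computable_from_def by blast
qed

text \<open>\<open>const_prog n\<close> grows with \<open>n\<close>, so its code is obtained by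
  primitive recursion. This is needed because \<open>c0\<close> is built into the final program as a
  constant.\<close>

lemma computable_from_const_prog [computable_intros]:
  assumes "computable_from A f"
  shows "computable_from A (\<lambda>e. prog_encode (const_prog (f e)))"
proof (rule computable_from_comp[OF assms])
  \<comment> \<open>One recursion step wraps a code in \<open>Comp Succ [_]\<close>: 3 is the tag of
    \<open>Comp\<close>, and the successor of a pair ending in 0 codes the one-element list.\<close>
  let ?g = "Comp pair_prog [const_prog 3, Comp pair_prog [const_prog (prog_encode Succ),
    Comp Succ [Comp pair_prog [Proj 1, Zero]]]]"
  fix n
  show "run (PrimRec (const_prog (prog_encode Zero)) ?g) [n] = Some (prog_encode (const_prog n))"
    by (rule run_PrimRec) auto
qed

lemma computable_from_Comp [computable_intros]:
  assumes "computable_from A (\<lambda>e. prog_encode (f e))"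
    and "computable_from A (\<lambda>e. list_encode (map prog_encode (gs e)))"
  shows "computable_from A (\<lambda>e. prog_encode (Comp (f e) (gs e)))"
  unfolding prog_encode.simps list.map list_encode.simps by (intro computable_intros assms)

lemma computable_from_Cons [computable_intros]:
  assumes "computable_from A (\<lambda>e. prog_encode (f e))"
    and "computable_from A (\<lambda>e. list_encode (map prog_encode (gs e)))"
  shows "computable_from A (\<lambda>e. list_encode (map prog_encode (f e # gs e)))"
  unfolding prog_encode.simps list.map list_encode.simps by (intro computable_intros assms)

lemma computable_from_PrimRec [computable_intros]:
  assumes "computable_from A (\<lambda>e. prog_encode (f e))" "computable_from A (\<lambda>e. prog_encode (g e))"
  shows "computable_from A (\<lambda>e. prog_encode (PrimRec (f e) (g e)))"
  unfolding prog_encode.simps list.map list_encode.simps by (intro computable_intros assms)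

lemma computable_from_Mu [computable_intros]:
  assumes "computable_from A (\<lambda>e. prog_encode (f e))"
  shows "computable_from A (\<lambda>e. prog_encode (Mu (f e)))"
  unfolding prog_encode.simps list.map list_encode.simps by (intro computable_intros assms)

text \<open>The arithmetic subprograms stay folded, as their codes are constants. The rest is built
  from the parameters by constructors and \<open>const_prog\<close>, so the rules follow the
  syntax.\<close>

lemma computable_from_cover_prog:
  assumes "computable_from A (\<lambda>e. prog_encode (pr e))" "computable_from A (\<lambda>e. prog_encode (pd e))"
    "computable_from A (\<lambda>e. prog_encode (ps e))" "computable_from A (\<lambda>e. prog_encode (pp e))"
    "computable_from A (\<lambda>e. prog_encode (p e))" "computable_from A c0"
  shows "computable_from A (\<lambda>e. prog_encode (cover_prog (pr e) (pd e) (ps e) (pp e) (p e) (c0 e)))"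
  unfolding cover_prog_def search_prog_def escape_prog_def included_prog_def ideal_prog_def
    reach_prog_def walk_prog_def bex_prog_def
  by (intro computable_intros assms)

lemma coverability_uniformly_decidable:
  "coverability_uniformly_decidable TYPE(('x, 'a) lts)"
proof -
  \<comment> \<open>An environment pairs a list of programs with an initial code. For lists shorter
    than five, \<open>fst e ! i\<close> is unspecified but still a program, so the equations hold
    for every \<open>e\<close>.\<close>
  let ?A = "\<lambda>e. map (\<lambda>i. prog_encode (fst e ! i)) [0, 1, 2, 3, 4] @ [snd e]"
  have q: "computable_from ?A (\<lambda>e. prog_encode (fst e ! i))" if "i < 5" for i
  proof -
    from that have "i = 0 \<or> i = 1 \<or> i = 2 \<or> i = 3 \<or> i = 4" by linarith
    then have "\<forall>e. run (Proj i) (?A e) = Some (prog_encode (fst e ! i))" by auto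
    then show ?thesis unfolding computable_from_def by blast
  qed
  have "\<forall>e. run (Proj 5) (?A e) = Some (snd e)" by simp
  then have "computable_from ?A snd" unfolding computable_from_def by blast
  then have "computable_from ?A (\<lambda>e. prog_encode
      (cover_prog (fst e ! 0) (fst e ! 1) (fst e ! 2) (fst e ! 3) (fst e ! 4) (snd e)))"
    by (intro computable_from_cover_prog q) auto
  then obtain t where t: "\<And>e. run t (?A e) = Some (prog_encode
      (cover_prog (fst e ! 0) (fst e ! 1) (fst e ! 2) (fst e ! 3) (fst e ! 4) (snd e)))"
    unfolding computable_from_def by blast
  show ?thesis
    unfolding coverability_uniformly_decidable_def
  proof (rule exI[of _ t], intro allI impI)
    fix S :: "('x, 'a) lts" and eX eI pr pd ps pp p c0
    assume "cover_wsts S \<and> ideally_effective_by S eX eI pr pd ps pp \<and>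
      Post_computable_by S eX p \<and> eX c0 = Some (init S)"
    then have "effective_cover_wsts S eX eI pr pd ps pp p c0"
      unfolding effective_cover_wsts_def by blast
    then have "coverability_decidable_by S eX (cover_prog pr pd ps pp p c0)"
      by (rule effective_cover_wsts.coverability_decidable_by_cover_prog)
    moreover have "run t (map prog_encode [pr, pd, ps, pp, p] @ [c0]) =
        Some (prog_encode (cover_prog pr pd ps pp p c0))"
      using t[of "([pr, pd, ps, pp, p], c0)"] by simp
    ultimately show "\<exists>q. run t (map prog_encode [pr, pd, ps, pp, p] @ [c0]) =
        Some (prog_encode q) \<and> coverability_decidable_by S eX q"
      by blast
  qed
qed

theorem theorem5p9:
  "(\<forall>(S :: ('x, 'a) lts) eX eI.
      cover_wsts S \<and> ideally_effective S eX eI \<and> Post_computable S eX \<longrightarrow>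
      coverability_decidable S eX) \<and>
   coverability_uniformly_decidable TYPE(('x, 'a) lts)"
proof (intro conjI allI impI)
  fix S :: "('x, 'a) lts" and eX eI
  assume S: "cover_wsts S \<and> ideally_effective S eX eI \<and> Post_computable S eX"
  then obtain pr pd ps pp p where w: "ideally_effective_by S eX eI pr pd ps pp"
    "Post_computable_by S eX p"
    unfolding ideally_effective_def Post_computable_def by blast
  \<comment> \<open>\<open>eX\<close> is onto the states, so the initial state has some code; any of
    them will do.\<close>
  moreover have "init S \<in> ran eX"
    using S w(1) unfolding cover_wsts_def ordered_lts_def ideally_effective_by_def by blast
  then obtain c0 where "eX c0 = Some (init S)" unfolding ran_def by blast
  ultimately have "effective_cover_wsts S eX eI pr pd ps pp p c0"
    using S unfolding effective_cover_wsts_def by blast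
  then show "coverability_decidable S eX"
    unfolding coverability_decidable_def
    by (blast dest: effective_cover_wsts.coverability_decidable_by_cover_prog)
qed (rule coverability_uniformly_decidable)

end
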